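(* Let $p\in[-1,1]$, $p\ne0$, and let $P=(\frac15,\frac15,\frac15,\frac15,\frac15)$. For any $x^{(0)}\in\mathrm{int}\,S^4$ with $x^{(0)}\neq P$, the set of limit points of the trajectory $\{W^n(x^{(0)})\}_{n\ge0}$ is infinite and lies on the boundary $\partial S^4$ of the simplex $S^4$.
   Context: $S^4=\{x=(x_1,\dots,x_5)\in\mathbb{R}^5: x_i\ge 0,\ \sum_{i=1}^5 x_i=1\}$, $\mathrm{int}\,S^4=\{x\in S^4:x_1x_2x_3x_4x_5>0\}$, $\partial S^4=\{x\in S^4: x_1x_2x_3x_4x_5=0\}$. For $p\in[-1,1]$, the operator $W:S^4\to S^4$, $W(x)=x'$, is defined by $$\begin{aligned} x'_1&=x_5[1+p(x_1-x_2+x_3-x_4)],\\ x'_2&=x_1[1+p(x_2-x_3+x_4-x_5)],\\ x'_3&=x_2[1-p(x_1-x_3+x_4-x_5)],\\ x'_4&=x_3[1+p(x_1-x_2+x_4-x_5)],\\ x'_5&=x_4[1-p(x_1-x_2+x_3-x_5)]. \end{aligned}$$ $W^n$ is the $n$-th iterate of $W$; limit points are subsequential limits. *)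

theory Defs
  imports "HOL-Analysis.Analysis"
begin

text \<open>
  The index type of \<open>real ^ 5\<close> is the numeral type \<open>5\<close>, i.e. the integers modulo 5.
  Its elements are \<open>1, 2, 3, 4, 5\<close>, where \<open>5\<close> coincides with \<open>0\<close>, so \<open>x $ 5\<close> is the
  fifth coordinate.
\<close>

lemma exhaust_5:
  fixes i :: 5
  shows "i = 1 \<or> i = 2 \<or> i = 3 \<or> i = 4 \<or> i = 5"
proof (induct i)
  case (of_int z)
  then have "0 \<le> z" "z < 5" by simp_all
  then have "z = 0 \<or> z = 1 \<or> z = 2 \<or> z = 3 \<or> z = 4" by arith
  then show ?case by auto
qed

lemma forall_5: "(\<forall>i::5. Q i) \<longleftrightarrow> Q 1 \<and> Q 2 \<and> Q 3 \<and> Q 4 \<and> Q 5"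
  by (metis exhaust_5)

lemma UNIV_5: "UNIV = {1, 2, 3, 4, 5 :: 5}"
  using exhaust_5 by auto

lemma sum_5: "sum f (UNIV :: 5 set) = f 1 + f 2 + f 3 + f 4 + f 5"
  unfolding UNIV_5 by (simp add: ac_simps)

lemma vector_5 [simp]:
  "(vector [a, b, c, d, e] :: 'a::zero ^ 5) $ 1 = a"
  "(vector [a, b, c, d, e] :: 'a ^ 5) $ 2 = b"
  "(vector [a, b, c, d, e] :: 'a ^ 5) $ 3 = c"
  "(vector [a, b, c, d, e] :: 'a ^ 5) $ 4 = d"
  "(vector [a, b, c, d, e] :: 'a ^ 5) $ 5 = e"
  unfolding vector_def by simp_all

definition S4 :: "(real ^ 5) set" where
  "S4 = {x. (\<forall>i. 0 \<le> x $ i) \<and> (\<Sum>i\<in>UNIV. x $ i) = 1}"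

definition int_S4 :: "(real ^ 5) set" where
  "int_S4 = {x \<in> S4. x $ 1 * x $ 2 * x $ 3 * x $ 4 * x $ 5 > 0}"

definition boundary_S4 :: "(real ^ 5) set" where
  "boundary_S4 = {x \<in> S4. x $ 1 * x $ 2 * x $ 3 * x $ 4 * x $ 5 = 0}"

text \<open>
  \<open>W p\<close> is given by its formula on all of \<open>real ^ 5\<close>; lemma \<open>W_maps_S4\<close> shows that it
  restricts to a self-map of the simplex when \<open>p \<in> {-1..1}\<close>.
\<close>

definition W :: "real \<Rightarrow> real ^ 5 \<Rightarrow> real ^ 5" where
  "W p x = vector
    [x $ 5 * (1 + p * (x $ 1 - x $ 2 + x $ 3 - x $ 4)),
     x $ 1 * (1 + p * (x $ 2 - x $ 3 + x $ 4 - x $ 5)),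
     x $ 2 * (1 - p * (x $ 1 - x $ 3 + x $ 4 - x $ 5)),
     x $ 3 * (1 + p * (x $ 1 - x $ 2 + x $ 4 - x $ 5)),
     x $ 4 * (1 - p * (x $ 1 - x $ 2 + x $ 3 - x $ 5))]"

lemma W_maps_S4:
  assumes p: "p \<in> {-1..1}" and x: "x \<in> S4"
  shows "W p x \<in> S4"
proof -
  have nonneg: "0 \<le> x $ 1" "0 \<le> x $ 2" "0 \<le> x $ 3" "0 \<le> x $ 4" "0 \<le> x $ 5"
    and total: "x $ 1 + x $ 2 + x $ 3 + x $ 4 + x $ 5 = 1"
    using x by (auto simp: S4_def sum_5)
  have bound: "\<bar>p * t\<bar> \<le> 1" if "\<bar>t\<bar> \<le> 1" for t
    using p that mult_mono[of "\<bar>p\<bar>" 1 "\<bar>t\<bar>" 1] by (auto simp: abs_mult)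
  have "\<bar>p * (x $ 1 - x $ 2 + x $ 3 - x $ 4)\<bar> \<le> 1"
    "\<bar>p * (x $ 2 - x $ 3 + x $ 4 - x $ 5)\<bar> \<le> 1"
    "\<bar>p * (x $ 1 - x $ 3 + x $ 4 - x $ 5)\<bar> \<le> 1"
    "\<bar>p * (x $ 1 - x $ 2 + x $ 4 - x $ 5)\<bar> \<le> 1"
    "\<bar>p * (x $ 1 - x $ 2 + x $ 3 - x $ 5)\<bar> \<le> 1"
    by (rule bound, use nonneg total in linarith)+
  then have "\<forall>i. 0 \<le> W p x $ i"
    unfolding forall_5 W_def vector_5
    by (intro conjI mult_nonneg_nonneg nonneg) linarith+
  moreover have "(\<Sum>i\<in>UNIV. W p x $ i) = x $ 1 + x $ 2 + x $ 3 + x $ 4 + x $ 5"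
    unfolding sum_5 W_def vector_5 by (simp add: algebra_simps)
  ultimately show ?thesis
    using total by (simp add: S4_def)
qed

text \<open>
  Subsequential limits of a sequence. This differs from accumulation points of its range: a value
  taken infinitely often is a subsequential limit.
\<close>

definition limit_points :: "(nat \<Rightarrow> 'a::topological_space) \<Rightarrow> 'a set" where
  "limit_points X = {l. \<exists>r :: nat \<Rightarrow> nat. strict_mono r \<and> (X \<circ> r) \<longlonglongrightarrow> l}"

end

theory Submission
  imports Defs
begin

text \<open>
  Number the coordinates by the integers modulo 5. Then \<open>W\<close> is the cyclic shift of the
  coordinates after a Volterra map \<open>x\<^sub>i \<mapsto> x\<^sub>i (1 + p A\<^sub>i x)\<close>, where the matrix of the linear forms
  \<open>A\<^sub>i\<close> (called \<open>adv i\<close> below) is skew-symmetric and circulant. The Volterra map commutes with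
  the shift, so \<open>W\<close> and the Volterra map have the same fifth iterate, and it suffices to
  study the latter. Two identities drive everything: \<open>\<Sum>\<^sub>i A\<^sub>i x = 0\<close>, because the matrix
  is circulant with vanishing row sum, and \<open>\<Sum>\<^sub>i x\<^sub>i A\<^sub>i x = 0\<close>, by skew symmetry.

  \<^bold>\<open>The limit points lie on the boundary.\<close> One step multiplies the product of the
  coordinates by \<open>\<Prod>\<^sub>i (1 + p A\<^sub>i x)\<close>. These factors have mean 1, so by the inequality of
  arithmetic and geometric means the product does not grow, and it is stationary only at the
  centre. The centre maximises the product strictly, so an orbit starting elsewhere cannot
  approach it. Hence the product tends to 0 (\<open>coordinate_product_tendsto_0\<close>).

  \<^bold>\<open>There are infinitely many of them.\<close> Suppose there are finitely many. The fifth iterate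
  permutes the finite set of limit points of its own orbit, so all of them are periodic for the
  Volterra map. A periodic point is fixed (\<open>volterra_periodic_imp_fixed\<close>): the growth factors of
  each surviving coordinate multiply to 1 along the cycle, which makes their logarithms average
  to 0; concavity of the logarithm and skew symmetry then force every factor to be 1. As the
  limit points are all fixed, the steps of this orbit tend to 0, and a sequence with vanishing
  steps and finitely many limit points converges. But the limit \<open>q\<close> is a fixed point other than
  the centre, and \<open>\<Sum>\<^sub>i p A\<^sub>i q = 0\<close> gives a coordinate with \<open>p A\<^sub>i q > 0\<close>. It vanishes at the
  fixed point \<open>q\<close>, yet it increases along the orbit near \<open>q\<close>, a contradiction
  (\<open>interior_orbit_not_convergent\<close>).
\<close>

section \<open>Limit points of orbits\<close>

lemma convergent_subsequence_in_compact:
  fixes y :: "nat \<Rightarrow> 'a::metric_space"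
  assumes "compact K" and "\<And>n. y n \<in> K"
  obtains l r where "l \<in> K" "strict_mono (r :: nat \<Rightarrow> nat)" "(y \<circ> r) \<longlonglongrightarrow> l"
  using assms unfolding compact_def by metis

lemma limit_points_compact_subset:
  fixes y :: "nat \<Rightarrow> 'a::metric_space"
  assumes "compact K" and "\<And>n. y n \<in> K"
  shows "limit_points y \<subseteq> K"
proof
  fix l assume "l \<in> limit_points y"
  then obtain r where "(y \<circ> r) \<longlonglongrightarrow> l" by (auto simp: limit_points_def)
  then show "l \<in> K"
    using closed_sequentially[OF compact_imp_closed[OF assms(1)], of "y \<circ> r" l] assms(2) by simp
qed

lemma limit_points_subseq_subset:
  fixes y :: "nat \<Rightarrow> 'a::topological_space"
  assumes "strict_mono r"
  shows "limit_points (y \<circ> r) \<subseteq> limit_points y"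
proof
  fix l assume "l \<in> limit_points (y \<circ> r)"
  then obtain s where "strict_mono s" "(y \<circ> r \<circ> s) \<longlonglongrightarrow> l" by (auto simp: limit_points_def)
  then show "l \<in> limit_points y"
    using assms strict_mono_o[of r s] by (auto simp: limit_points_def comp_assoc)
qed

lemma continuous_on_funpow:
  fixes T :: "'a::topological_space \<Rightarrow> 'a"
  assumes "continuous_on UNIV T"
  shows "continuous_on UNIV (T ^^ n)"
  by (induction n) (auto intro: continuous_on_compose2[OF assms] simp: continuous_on_id id_def o_def)

lemma tendsto_continuous_image:
  assumes "continuous_on UNIV T" and "y \<longlonglongrightarrow> l"
  shows "(\<lambda>n. T (y n)) \<longlonglongrightarrow> T l"
  using assms by (auto intro: continuous_on_tendsto_compose[of UNIV])

lemma orbit_limit_points_invariant: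
  fixes T :: "'a::metric_space \<Rightarrow> 'a"
  assumes K: "compact K" and cont: "continuous_on UNIV T" and orb: "\<And>n. (T ^^ n) x \<in> K"
  shows "T ` limit_points (\<lambda>n. (T ^^ n) x) = limit_points (\<lambda>n. (T ^^ n) x)"
    (is "T ` ?L = ?L")
proof
  show "T ` ?L \<subseteq> ?L"
  proof clarify
    fix l assume "l \<in> ?L"
    then obtain r where r: "strict_mono r" "(\<lambda>n. (T ^^ r n) x) \<longlonglongrightarrow> l"
      by (auto simp: limit_points_def o_def)
    have "strict_mono (\<lambda>n. Suc (r n))" using r(1) by (auto simp: strict_mono_def)
    moreover have "(\<lambda>n. (T ^^ Suc (r n)) x) \<longlonglongrightarrow> T l"
      using tendsto_continuous_image[OF cont r(2)] by simp
    ultimately show "T l \<in> ?L" unfolding limit_points_def o_def by blast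
  qed
next
  show "?L \<subseteq> T ` ?L"
  proof
    fix l assume "l \<in> ?L"
    then obtain r where r: "strict_mono r" "(\<lambda>n. (T ^^ r n) x) \<longlonglongrightarrow> l"
      by (auto simp: limit_points_def o_def)
    (* A preimage of l comes from the predecessors of the times r; skipping r 0, which may be 0,
       makes every predecessor exist. *)
    define s where "s n = r (Suc n) - 1" for n
    have s_Suc: "Suc (s n) = r (Suc n)" for n
      using seq_suble[OF r(1), of "Suc n"] by (simp add: s_def)
    have s: "strict_mono s"
      unfolding strict_mono_Suc_iff
      by (metis Suc_less_eq lessI r(1) s_Suc strict_monoD)
    obtain l' t where t: "strict_mono t" and l': "((\<lambda>n. (T ^^ s n) x) \<circ> t) \<longlonglongrightarrow> l'"
      using convergent_subsequence_in_compact[OF K, of "\<lambda>n. (T ^^ s n) x"] orb by metis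
    have "(\<lambda>n. T ((T ^^ s (t n)) x)) \<longlonglongrightarrow> T l'"
      using tendsto_continuous_image[OF cont l'] by simp
    then have "(\<lambda>n. (T ^^ r (Suc (t n))) x) \<longlonglongrightarrow> T l'"
      by (simp flip: s_Suc)
    moreover have "(\<lambda>n. (T ^^ r (Suc (t n))) x) \<longlonglongrightarrow> l"
      using LIMSEQ_subseq_LIMSEQ[OF r(2), of "\<lambda>n. Suc (t n)"] t
      by (simp add: strict_mono_def o_def)
    ultimately have "l = T l'" by (rule LIMSEQ_unique[rotated])
    moreover have "l' \<in> ?L"
      unfolding limit_points_def using strict_mono_o[OF s t] l' by (auto simp: o_def)
    ultimately show "l \<in> T ` ?L" by blast
  qed
qed

text \<open>An invariant finite set is permuted, so all its points are periodic.\<close>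

lemma finite_limit_points_periodic:
  fixes T :: "'a::metric_space \<Rightarrow> 'a"
  assumes "compact K" and "continuous_on UNIV T" and "\<And>n. (T ^^ n) x \<in> K"
    and fin: "finite (limit_points (\<lambda>n. (T ^^ n) x))" (is "finite ?L")
    and l: "l \<in> limit_points (\<lambda>n. (T ^^ n) x)"
  obtains N where "N > 0" "(T ^^ N) l = l"
proof -
  have img: "T ` ?L = ?L"
    using assms by (intro orbit_limit_points_invariant)
  then have "bij_betw T ?L ?L"
    using fin by (simp add: bij_betw_def finite_surj_inj)
  then have bij: "bij_betw (T ^^ n) ?L ?L" for n by (rule bij_betw_funpow)
  have "range (\<lambda>n. (T ^^ n) l) \<subseteq> ?L"
    using bij_betwE[OF bij] l by blast
  then have "\<not> inj (\<lambda>n. (T ^^ n) l)"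
    using fin finite_imageD finite_subset infinite_UNIV_nat by blast
  then obtain a b where "a < b" and eq: "(T ^^ a) l = (T ^^ b) l"
    unfolding inj_def by (metis linorder_neqE_nat)
  then obtain N where b: "b = a + N" and "N > 0" using less_imp_add_positive by blast
  have "(T ^^ a) l = (T ^^ a) ((T ^^ N) l)"
    using eq by (simp add: b funpow_add)
  then have "(T ^^ N) l = l"
    using bij_betw_imp_inj_on[OF bij, of a] bij_betwE[OF bij, of N] l
    by (metis inj_onD)
  with \<open>N > 0\<close> show thesis by (rule that)
qed

lemma eventually_avoids_closed_without_limit_points:
  fixes y :: "nat \<Rightarrow> 'a::metric_space"
  assumes K: "compact K" and yK: "\<And>n. y n \<in> K"
    and A: "closed A" "A \<inter> limit_points y = {}"
  shows "eventually (\<lambda>n. y n \<notin> A) sequentially"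
proof (rule ccontr)
  assume "\<not> ?thesis"
  then have "\<exists>\<^sub>F n in sequentially. y n \<in> A" by (simp add: frequently_def)
  then have "infinite {n. y n \<in> A}"
    by (simp add: frequently_cofinite flip: cofinite_eq_sequentially)
  then obtain r :: "nat \<Rightarrow> nat" where r: "strict_mono r" "\<And>n. y (r n) \<in> A"
    using infinite_enumerate by blast
  obtain m s where s: "strict_mono s" and m: "((y \<circ> r) \<circ> s) \<longlonglongrightarrow> m"
    using convergent_subsequence_in_compact[OF K, of "y \<circ> r"] yK by (metis comp_apply)
  have "m \<in> A" using closed_sequentially[OF A(1) _ m] r(2) by simp
  moreover have "m \<in> limit_points y"
    unfolding limit_points_def using strict_mono_o[OF r(1) s] m by (auto simp: comp_assoc)
  ultimately show False using A(2) by blast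
qed

text \<open>
  To move away from a limit point, a sequence with vanishing steps has to land in each shell
  around it that is wider than the late steps. By compactness, a shell free of limit points is
  visited only finitely often, so it traps the sequence inside.
\<close>

lemma convergent_if_steps_vanish_finite_limit_points:
  fixes y :: "nat \<Rightarrow> 'a::metric_space"
  assumes K: "compact K" and yK: "\<And>n. y n \<in> K"
    and steps: "(\<lambda>n. dist (y (Suc n)) (y n)) \<longlonglongrightarrow> 0"
    and fin: "finite (limit_points y)" and l: "l \<in> limit_points y"
  shows "y \<longlonglongrightarrow> l"
proof -
  obtain D where D: "D > 0" "\<And>m. m \<in> limit_points y \<Longrightarrow> m \<noteq> l \<Longrightarrow> D \<le> dist l m"
    using finite_set_avoid[OF fin, of l] by blast
  show ?thesis
  proof (rule metric_LIMSEQ_I)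
    fix e :: real assume "e > 0"
    define d where "d = min e D / 2"
    have d: "0 < d" "d < e" "2 * d \<le> D" using \<open>e > 0\<close> D(1) by (auto simp: d_def)
    (* The shell has width d/2, which exceeds the late steps, and it lies within distance less
       than D of l, so it contains no limit point. *)
    define A where "A = {z. d \<le> dist z l \<and> dist z l \<le> 3/2 * d}"
    have "closed A"
      unfolding A_def by (intro closed_Collect_conj closed_Collect_le continuous_intros)
    moreover have "A \<inter> limit_points y = {}"
      using D(2) d by (fastforce simp: A_def dist_commute)
    ultimately have "eventually (\<lambda>n. y n \<notin> A) sequentially"
      by (rule eventually_avoids_closed_without_limit_points[OF K yK])
    then obtain k where k: "\<And>n. n \<ge> k \<Longrightarrow> y n \<notin> A" by (auto simp: eventually_sequentially)
    have "eventually (\<lambda>n. dist (y (Suc n)) (y n) < d / 2) sequentially"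
      using order_tendstoD(2)[OF steps, of "d/2"] d by simp
    then obtain k' where k': "\<And>n. n \<ge> k' \<Longrightarrow> dist (y (Suc n)) (y n) < d / 2"
      by (auto simp: eventually_sequentially)
    define n0 where "n0 = max k k'"
    have n0: "y n \<notin> A" "dist (y (Suc n)) (y n) < d / 2" if "n \<ge> n0" for n
      using that k k' by (auto simp: n0_def)
    obtain r where r: "strict_mono r" "(y \<circ> r) \<longlonglongrightarrow> l"
      using l by (auto simp: limit_points_def)
    have "eventually (\<lambda>n. dist (y (r n)) l < d) sequentially"
      using r(2) d by (auto simp: tendsto_iff)
    then obtain n1 where n1: "\<And>n. n \<ge> n1 \<Longrightarrow> dist (y (r n)) l < d"
      by (auto simp: eventually_sequentially)
    define m where "m = r (max n0 n1)"
    have m: "m \<ge> n0" "dist (y m) l < d"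
      using n1[of "max n0 n1"] seq_suble[OF r(1), of "max n0 n1"] by (auto simp: m_def)
    have "dist (y n) l < d" if "n \<ge> m" for n
      using that
    proof (induction n rule: dec_induct)
      case base
      show ?case by (rule m(2))
    next
      case (step n)
      have "dist (y (Suc n)) l \<le> dist (y (Suc n)) (y n) + dist (y n) l"
        by (rule dist_triangle)
      also have "\<dots> \<le> 3/2 * d"
        using n0[of n] m(1) step by simp
      finally show ?case
        using n0[of "Suc n"] m(1) step by (auto simp: A_def)
    qed
    then show "\<exists>no. \<forall>n\<ge>no. dist (y n) l < e"
      using d(2) by (meson less_trans)
  qed
qed

section \<open>Products of nonnegative numbers with bounded sum\<close>

text \<open>
  Sum the inequality \<open>ln u \<le> u - 1\<close>, whose only equality case is \<open>u = 1\<close>.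
\<close>

lemma prod_ge_one_sum_le_card_imp_one:
  fixes t :: "'i \<Rightarrow> real"
  assumes fin: "finite A" and nonneg: "\<And>j. j \<in> A \<Longrightarrow> 0 \<le> t j"
    and prod: "1 \<le> (\<Prod>j\<in>A. t j)" and sum: "(\<Sum>j\<in>A. t j - 1) \<le> 0" and j: "j \<in> A"
  shows "t j = 1"
proof -
  have pos: "0 < t i" if "i \<in> A" for i
  proof -
    have "t i \<noteq> 0" using prod prod_zero[OF fin] that by fastforce
    then show ?thesis using nonneg[OF that] by simp
  qed
  have "0 \<le> ln (\<Prod>j\<in>A. t j)" using prod by simp
  also have "\<dots> = (\<Sum>j\<in>A. ln (t j))" using pos by (intro ln_prod[OF fin]) force
  finally have ln: "0 \<le> (\<Sum>j\<in>A. ln (t j))" .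
  have le: "0 \<le> t i - 1 - ln (t i)" if "i \<in> A" for i
    using ln_le_minus_one[OF pos[OF that]] by simp
  have "(\<Sum>i\<in>A. t i - 1 - ln (t i)) \<le> 0"
    using ln sum by (simp add: sum_subtractf)
  then have "(\<Sum>i\<in>A. t i - 1 - ln (t i)) = 0"
    using sum_nonneg[of A "\<lambda>i. t i - 1 - ln (t i)"] le by simp
  then have "t j - 1 - ln (t j) = 0"
    using sum_nonneg_eq_0_iff[OF fin, of "\<lambda>i. t i - 1 - ln (t i)"] le j by blast
  then show ?thesis using ln_eq_minus_one[OF pos[OF j]] by simp
qed

lemma prod_le_one_if_sum_le_card:
  fixes t :: "'i \<Rightarrow> real"
  assumes "finite A" and "\<And>j. j \<in> A \<Longrightarrow> 0 \<le> t j" and "(\<Sum>j\<in>A. t j - 1) \<le> 0"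
  shows "(\<Prod>j\<in>A. t j) \<le> 1"
proof (rule ccontr)
  assume "\<not> ?thesis"
  then have "1 \<le> (\<Prod>j\<in>A. t j)" by simp
  from prod_ge_one_sum_le_card_imp_one[OF assms(1,2) this assms(3)]
  have "(\<Prod>j\<in>A. t j) = 1" by (intro prod.neutral) blast
  with \<open>\<not> ?thesis\<close> show False by simp
qed

section \<open>The Volterra map behind the operator\<close>

text \<open>
  Indices live in the integers modulo 5, so the five brackets of \<open>W\<close> are the rotations of
  a single linear form.
\<close>

definition adv :: "5 \<Rightarrow> real ^ 5 \<Rightarrow> real" where
  "adv i x = x $ (i + 1) - x $ (i + 2) + x $ (i + 3) - x $ (i + 4)"

definition volterra :: "real \<Rightarrow> real ^ 5 \<Rightarrow> real ^ 5" where
  "volterra p x = (\<chi> i. x $ i * (1 + p * adv i x))"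

lemma volterra_nth: "volterra p x $ i = x $ i * (1 + p * adv i x)"
  by (simp add: volterra_def)

lemma numerals_mod_5: "(6 :: 5) = 1" "(7 :: 5) = 2" "(8 :: 5) = 3" "(9 :: 5) = 4"
  by simp_all

lemma W_nth_Suc: "W p x $ (i + 1) = volterra p x $ i"
  using exhaust_5[of i]
  by (elim disjE) (simp_all add: W_def volterra_def adv_def numerals_mod_5 algebra_simps)

lemma adv_simps:
  "adv 1 x = x $ 2 - x $ 3 + x $ 4 - x $ 5"
  "adv 2 x = x $ 3 - x $ 4 + x $ 5 - x $ 1"
  "adv 3 x = x $ 4 - x $ 5 + x $ 1 - x $ 2"
  "adv 4 x = x $ 5 - x $ 1 + x $ 2 - x $ 3"
  "adv 5 x = x $ 1 - x $ 2 + x $ 3 - x $ 4"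
  by (simp_all add: adv_def numerals_mod_5)


lemma sum_adv: "(\<Sum>i\<in>UNIV. adv i x) = 0"
  by (simp add: sum_5 adv_simps)

lemma sum_growth_factor: "(\<Sum>i\<in>UNIV. 1 + p * adv i x - 1) = 0"
proof -
  have "(\<Sum>i\<in>UNIV. 1 + p * adv i x - 1) = p * (\<Sum>i\<in>UNIV. adv i x)"
    unfolding sum_distrib_left by (rule sum.cong) simp_all
  then show ?thesis by (simp only: sum_adv mult_zero_right)
qed

lemma sum_mult_adv: "(\<Sum>i\<in>UNIV. x $ i * adv i x) = 0"
  by (simp add: sum_5 adv_simps algebra_simps)

lemma adv_sum: "adv i (\<Sum>j\<in>A. q j) = (\<Sum>j\<in>A. adv i (q j))"
  by (simp add: adv_def sum.distrib sum_subtractf)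

text \<open>Two cyclically adjacent forms add up to the difference of two adjacent coordinates.\<close>

lemma adv_eq_0_imp_centre:
  assumes "x \<in> S4" and "\<And>i. adv i x = 0"
  shows "x $ i = 1/5"
proof -
  have "x $ 1 = x $ 2" "x $ 2 = x $ 3" "x $ 3 = x $ 4" "x $ 4 = x $ 5"
    using assms(2)[of 1] assms(2)[of 2] assms(2)[of 3] assms(2)[of 4] assms(2)[of 5]
    unfolding adv_simps by linarith+
  moreover have "x $ 1 + x $ 2 + x $ 3 + x $ 4 + x $ 5 = 1"
    using assms(1) by (simp add: S4_def sum_5)
  ultimately show ?thesis
    using exhaust_5[of i] by auto
qed

text \<open>
  The bound leaves room for \<open>x $ i\<close>: thus a positive coordinate has a positive growth factor
  even when \<open>\<bar>p\<bar> = 1\<close>.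
\<close>

lemma abs_adv_le:
  assumes "x \<in> S4"
  shows "\<bar>adv i x\<bar> \<le> 1 - x $ i"
proof -
  have "0 \<le> x $ 1" "0 \<le> x $ 2" "0 \<le> x $ 3" "0 \<le> x $ 4" "0 \<le> x $ 5"
    and "x $ 1 + x $ 2 + x $ 3 + x $ 4 + x $ 5 = 1"
    using assms by (auto simp: S4_def sum_5)
  then show ?thesis
    using exhaust_5[of i] by (elim disjE; simp only: adv_simps; linarith)
qed

lemma growth_factor_ge:
  assumes "p \<in> {-1..1}" and "x \<in> S4"
  shows "x $ i \<le> 1 + p * adv i x"
proof -
  have "\<bar>p * adv i x\<bar> \<le> 1 * \<bar>adv i x\<bar>"
    unfolding abs_mult using assms(1) by (intro mult_right_mono) auto
  then show ?thesis using abs_adv_le[OF assms(2), of i] by linarith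
qed

lemma growth_factor_nonneg:
  assumes "p \<in> {-1..1}" and "x \<in> S4"
  shows "0 \<le> 1 + p * adv i x"
  using growth_factor_ge[OF assms, of i] assms(2) by (auto simp: S4_def intro: order_trans)

lemma volterra_in_S4:
  assumes "p \<in> {-1..1}" and "x \<in> S4"
  shows "volterra p x \<in> S4"
proof -
  have "0 \<le> volterra p x $ i" for i
    using growth_factor_nonneg[OF assms, of i] assms(2) by (auto simp: S4_def volterra_def)
  moreover have "(\<Sum>i\<in>UNIV. volterra p x $ i) = (\<Sum>i\<in>UNIV. x $ i) + p * (\<Sum>i\<in>UNIV. x $ i * adv i x)"
    by (simp add: volterra_def distrib_left sum.distrib sum_distrib_left mult.left_commute)
  ultimately show ?thesis
    using assms(2) by (simp add: S4_def sum_mult_adv)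
qed

lemma volterra_pow_in_S4:
  assumes "p \<in> {-1..1}" and "x \<in> S4"
  shows "(volterra p ^^ n) x \<in> S4"
  by (induction n) (simp_all add: assms(2) volterra_in_S4[OF assms(1)])

lemma volterra_pow_pos:
  assumes "p \<in> {-1..1}" and "x \<in> S4" and "\<And>i. 0 < x $ i"
  shows "0 < (volterra p ^^ n) x $ i"
proof (induction n arbitrary: i)
  case 0
  show ?case using assms(3) by simp
next
  case (Suc n)
  have "0 < 1 + p * adv i ((volterra p ^^ n) x)"
    using growth_factor_ge[OF assms(1) volterra_pow_in_S4[OF assms(1,2)], of n i] Suc[of i]
    by linarith
  with Suc[of i] show ?case by (simp add: volterra_nth)
qed

lemma volterra_pow_nth:
  "(volterra p ^^ n) x $ i = x $ i * (\<Prod>j<n. 1 + p * adv i ((volterra p ^^ j) x))"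
  by (induction n) (simp_all add: volterra_nth mult.assoc)

lemma continuous_on_adv [continuous_intros]: "continuous_on A (adv i)"
  unfolding adv_def by (intro continuous_intros)

lemma continuous_on_volterra: "continuous_on A (volterra p)"
  unfolding volterra_def by (intro continuous_intros)

text \<open>
  The linear forms are rotations of each other, so the shift commutes with the Volterra map and
  can be collected in front: \<open>n\<close> steps of \<open>W\<close> shift the coordinates by \<open>n\<close>.
\<close>

lemma W_pow_nth:
  "(W p ^^ n) x $ (i + of_nat n) = (volterra p ^^ n) x $ i"
proof (induction n arbitrary: i)
  case 0
  show ?case by simp
next
  case (Suc n)
  have shift: "(W p ^^ n) x $ (i + of_nat n + c) = (volterra p ^^ n) x $ (i + c)" for c
    using Suc[of "i + c"] by (simp add: add_ac)
  have "(W p ^^ Suc n) x $ (i + of_nat (Suc n)) = W p ((W p ^^ n) x) $ (i + of_nat n + 1)"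
    by (simp add: add_ac)
  also have "\<dots> = volterra p ((W p ^^ n) x) $ (i + of_nat n)" by (rule W_nth_Suc)
  also have "\<dots> = (volterra p ^^ Suc n) x $ i"
    using shift[of 0] by (simp add: volterra_nth adv_def shift)
  finally show ?case .
qed

lemma W_pow_multiple_5: "(W p ^^ (5 * n)) x = (volterra p ^^ (5 * n)) x"
proof -
  have "(of_nat (5 * n) :: 5) = of_nat 5 * of_nat n" by (rule of_nat_mult)
  also have "(of_nat 5 :: 5) = 0" by simp
  finally show ?thesis
    using W_pow_nth[of "5 * n" p x] by (simp add: vec_eq_iff del: of_nat_mult)
qed

lemma prod_W_pow:
  "(\<Prod>i\<in>UNIV. (W p ^^ n) x $ i) = (\<Prod>i\<in>UNIV. (volterra p ^^ n) x $ i)"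
  by (rule prod.reindex_bij_witness[of _ "\<lambda>i. i + of_nat n" "\<lambda>i. i - of_nat n"])
    (use W_pow_nth[of n p x] in \<open>auto simp: algebra_simps, metis diff_add_cancel\<close>)

lemma prod_5: "(\<Prod>i\<in>UNIV. f (i :: 5)) = f 1 * f 2 * f 3 * f 4 * f 5"
  unfolding UNIV_5 by (simp add: ac_simps)

lemma compact_S4: "compact S4"
proof -
  have "bounded S4"
  proof (rule boundedI)
    fix x assume "x \<in> S4"
    then have "\<And>i. 0 \<le> x $ i" "(\<Sum>i\<in>UNIV. x $ i) = 1" by (auto simp: S4_def)
    then show "norm x \<le> 1" using norm_le_l1_cart[of x] by simp
  qed
  moreover have "closed S4"
    unfolding S4_def
    by (intro closed_Collect_conj closed_Collect_all closed_Collect_le closed_Collect_eq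
        continuous_intros)
  ultimately show ?thesis by (simp add: compact_eq_bounded_closed)
qed

section \<open>The product of the coordinates\<close>

lemma centre_if_growth_product_ge_one:
  assumes "p \<in> {-1..1}" and "p \<noteq> 0" and "x \<in> S4"
    and "1 \<le> (\<Prod>i\<in>UNIV. 1 + p * adv i x)"
  shows "x $ i = 1/5"
proof (rule adv_eq_0_imp_centre[OF assms(3)])
  fix i
  have "1 + p * adv i x = 1"
  proof (rule prod_ge_one_sum_le_card_imp_one[of UNIV "\<lambda>i. 1 + p * adv i x"])
    show "(\<Sum>j\<in>UNIV. 1 + p * adv j x - 1) \<le> 0" by (simp only: sum_growth_factor order.refl)
    show "0 \<le> 1 + p * adv j x" for j by (rule growth_factor_nonneg[OF assms(1,3)])
  qed (use assms(4) in simp_all)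
  then show "adv i x = 0" using assms(2) by simp
qed

lemma growth_product_le_one:
  assumes "p \<in> {-1..1}" and "x \<in> S4"
  shows "(\<Prod>i\<in>UNIV. 1 + p * adv i x) \<le> 1"
proof (rule prod_le_one_if_sum_le_card)
  show "(\<Sum>j\<in>UNIV. 1 + p * adv j x - 1) \<le> 0" by (simp only: sum_growth_factor order.refl)
qed (use growth_factor_nonneg[OF assms] in simp_all)

lemma centre_if_coordinate_product_maximal:
  assumes "x \<in> S4" and "(1/5) ^ 5 \<le> (\<Prod>i\<in>UNIV. x $ i)"
  shows "x $ i = 1/5"
proof -
  have "5 * x $ i = 1"
  proof (rule prod_ge_one_sum_le_card_imp_one[of UNIV "\<lambda>i. 5 * x $ i"])
    show "1 \<le> (\<Prod>i\<in>UNIV. 5 * x $ i)"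
      using assms(2) by (simp add: prod_5 power_divide)
    show "(\<Sum>i\<in>UNIV. 5 * x $ i - 1) \<le> 0"
      using assms(1) by (simp add: S4_def sum_5)
  qed (use assms(1) in \<open>auto simp: S4_def\<close>)
  then show ?thesis by simp
qed

lemma prod_volterra:
  "(\<Prod>i\<in>UNIV. volterra p x $ i) = (\<Prod>i\<in>UNIV. x $ i) * (\<Prod>i\<in>UNIV. 1 + p * adv i x)"
  by (simp add: volterra_def prod.distrib)

text \<open>
  The product of the coordinates is a Lyapunov function. It has the same value at an accumulation
  point and at the image of this point; if that value were positive, the accumulation point would
  be the centre, where the product is larger than it was at the start.
\<close>

lemma coordinate_product_tendsto_0:
  assumes p: "p \<in> {-1..1}" "p \<noteq> 0" and x: "x \<in> S4" and "\<not> (\<forall>i. x $ i = 1/5)"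
  shows "(\<lambda>n. \<Prod>i\<in>UNIV. (volterra p ^^ n) x $ i) \<longlonglongrightarrow> 0"
proof -
  define \<phi> where "\<phi> z = (\<Prod>i\<in>UNIV. z $ i)" for z :: "real ^ 5"
  define z where "z n = (volterra p ^^ n) x" for n
  have zS: "z n \<in> S4" for n unfolding z_def by (rule volterra_pow_in_S4[OF p(1) x])
  have \<phi>_nonneg: "0 \<le> \<phi> y" if "y \<in> S4" for y
    using that by (auto simp: \<phi>_def S4_def intro: prod_nonneg)
  have cont: "continuous_on UNIV \<phi>" unfolding \<phi>_def by (intro continuous_intros)
  have "\<phi> (z (Suc n)) \<le> \<phi> (z n)" for n
    using mult_left_mono[OF growth_product_le_one[OF p(1) zS[of n]] \<phi>_nonneg[OF zS[of n]]]
    by (simp add: z_def \<phi>_def prod_volterra)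
  then have dec: "decseq (\<lambda>n. \<phi> (z n))" by (rule decseq_SucI)
  then obtain c where c: "(\<lambda>n. \<phi> (z n)) \<longlonglongrightarrow> c" and c_le: "\<And>n. c \<le> \<phi> (z n)"
    using decseq_convergent[of "\<lambda>n. \<phi> (z n)" 0] \<phi>_nonneg[OF zS] by blast
  obtain l r where l: "l \<in> S4" and r: "strict_mono r" "(z \<circ> r) \<longlonglongrightarrow> l"
    using convergent_subsequence_in_compact[OF compact_S4, of z] zS by blast
  have "(\<lambda>n. \<phi> (z (r n))) \<longlonglongrightarrow> \<phi> l"
    using tendsto_continuous_image[OF cont r(2)] by simp
  then have \<phi>l: "\<phi> l = c"
    using LIMSEQ_subseq_LIMSEQ[OF c r(1)] by (auto simp: o_def intro: LIMSEQ_unique)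
  have "(\<lambda>n. \<phi> (volterra p (z (r n)))) \<longlonglongrightarrow> \<phi> (volterra p l)"
    using tendsto_continuous_image[OF cont tendsto_continuous_image[OF continuous_on_volterra r(2)]]
    by simp
  moreover have "(\<lambda>n. \<phi> (z (Suc (r n)))) \<longlonglongrightarrow> c"
    using LIMSEQ_subseq_LIMSEQ[OF c, of "\<lambda>n. Suc (r n)"] r(1) by (simp add: strict_mono_def o_def)
  ultimately have "\<phi> (volterra p l) = c"
    by (auto simp: z_def intro: LIMSEQ_unique)
  then have stationary: "c * (\<Prod>i\<in>UNIV. 1 + p * adv i l) = c"
    using \<phi>l by (simp add: \<phi>_def prod_volterra)
  have "c = 0"
  proof (rule ccontr)
    assume "c \<noteq> 0"
    then have centre: "l $ i = 1/5" for i
      using stationary by (intro centre_if_growth_product_ge_one[OF p l]) simp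
    have "\<phi> l = (1/5) ^ 5" unfolding \<phi>_def prod_5 centre by (simp add: power_divide)
    then have "c = (1/5) ^ 5" using \<phi>l by simp
    then have "(1/5) ^ 5 \<le> (\<Prod>i\<in>UNIV. x $ i)"
      using c_le[of 0] by (simp add: z_def \<phi>_def)
    then show False
      using centre_if_coordinate_product_maximal[OF x] assms(4) by blast
  qed
  with c show ?thesis by (simp add: z_def \<phi>_def)
qed

section \<open>Periodic points and convergent orbits\<close>

text \<open>
  Let \<open>b\<close> be the sum of the points of the cycle. On the coordinates that survive, the growth
  factors have product 1 over one period, so \<open>p * adv i b \<ge> 0\<close>, with equality only if all
  factors are 1. Skew symmetry at \<open>b\<close>, whose support is that of the cycle, yields equality.
\<close>

lemma volterra_periodic_imp_fixed:
  assumes p: "p \<in> {-1..1}" and x: "x \<in> S4"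
    and per: "(volterra p ^^ N) x = x" and N: "N > 0"
  shows "volterra p x = x"
proof -
  define q where "q j = (volterra p ^^ j) x" for j
  define t where "t i j = 1 + p * adv i (q j)" for i j
  define b where "b = (\<Sum>j<N. q j)"
  have q0: "q 0 = x" by (simp add: q_def)
  have qS: "q j \<in> S4" for j unfolding q_def by (rule volterra_pow_in_S4[OF p x])
  have t_nonneg: "0 \<le> t i j" for i j unfolding t_def by (rule growth_factor_nonneg[OF p qS])
  have t_sum: "(\<Sum>j<N. t i j - 1) = p * adv i b" for i
    by (simp add: t_def b_def adv_sum sum_distrib_left)
  have t_prod: "(\<Prod>j<N. t i j) = 1" if "x $ i \<noteq> 0" for i
    using volterra_pow_nth[of N p x i] per that by (simp add: t_def q_def)
  have b_zero: "b $ i = 0" if "x $ i = 0" for i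
    using that volterra_pow_nth[of _ p x i] by (simp add: b_def q_def)
  have b_pos: "0 < b $ i" if "x $ i \<noteq> 0" for i
  proof -
    have "x $ i \<le> b $ i"
      using member_le_sum[of 0 "{..<N}" "\<lambda>j. q j $ i"] N qS q0
      by (simp add: b_def S4_def)
    moreover have "0 \<le> x $ i" using x by (simp add: S4_def)
    ultimately show ?thesis using that by simp
  qed
  have nonneg: "0 \<le> p * adv i b" if "x $ i \<noteq> 0" for i
  proof (rule ccontr)
    assume neg: "\<not> 0 \<le> p * adv i b"
    then have "t i j = 1" if "j < N" for j
      using prod_ge_one_sum_le_card_imp_one[of "{..<N}" "t i" j] t_nonneg t_prod[OF \<open>x $ i \<noteq> 0\<close>]
        t_sum[of i] that by auto
    then show False using t_sum[of i] neg by auto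
  qed
  have terms: "0 \<le> b $ i * (p * adv i b)" for i
    using nonneg[of i] b_pos[of i] b_zero[of i] by (cases "x $ i = 0") auto
  have "(\<Sum>i\<in>UNIV. b $ i * (p * adv i b)) = p * (\<Sum>i\<in>UNIV. b $ i * adv i b)"
    by (simp add: sum_distrib_left mult.left_commute)
  then have "(\<Sum>i\<in>UNIV. b $ i * (p * adv i b)) = 0" by (simp add: sum_mult_adv)
  then have zero: "b $ i * (p * adv i b) = 0" for i
    using sum_nonneg_eq_0_iff[of UNIV "\<lambda>i. b $ i * (p * adv i b)"] terms by simp
  have "x $ i * (1 + p * adv i x) = x $ i" for i
  proof (cases "x $ i = 0")
    case False
    then have "(\<Sum>j<N. t i j - 1) \<le> 0"
      using zero[of i] b_pos[of i] t_sum[of i] by auto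
    then have "t i 0 = 1"
      using prod_ge_one_sum_le_card_imp_one[of "{..<N}" "t i" 0] t_nonneg t_prod[OF False] N
      by simp
    then show ?thesis by (simp add: t_def q0)
  qed simp
  then show ?thesis by (simp add: volterra_def vec_eq_iff)
qed

lemma boundary_point_has_growing_coordinate:
  assumes "p \<noteq> 0" and "q \<in> S4" and "(\<Prod>i\<in>UNIV. q $ i) = 0"
  obtains i where "0 < p * adv i q"
proof (rule ccontr)
  assume "\<not> thesis"
  then have le: "p * adv i q \<le> 0" for i using that not_le by blast
  have "(\<Sum>i\<in>UNIV. p * adv i q) = 0"
    using sum_growth_factor[of p q] by simp
  then have "p * adv i q = 0" for i
    using sum_nonneg_eq_0_iff[of UNIV "\<lambda>i. - (p * adv i q)"] le by (auto simp: sum_negf)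
  then have "q $ i = 1/5" for i
    using adv_eq_0_imp_centre[OF assms(2)] assms(1) by simp
  then show False using assms(3) by (simp only: prod_5)
qed

text \<open>
  A coordinate with \<open>0 < p * adv i q\<close> eventually increases along an orbit that tends to \<open>q\<close>, so
  it is positive at \<open>q\<close>; but there the same factor makes it grow, and \<open>q\<close> is fixed.
\<close>

lemma interior_orbit_not_convergent:
  assumes p: "p \<in> {-1..1}" "p \<noteq> 0" and x: "x \<in> S4" "\<And>i. 0 < x $ i"
    and lim: "(\<lambda>n. ((volterra p ^^ M) ^^ n) x) \<longlonglongrightarrow> q" and M: "M > 0"
    and fixed: "volterra p q = q" and q: "q \<in> S4" "(\<Prod>i\<in>UNIV. q $ i) = 0"
  shows False
proof -
  define y where "y n = ((volterra p ^^ M) ^^ n) x" for n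
  define G where "G i u = (\<Prod>k<M. 1 + p * adv i ((volterra p ^^ k) u))" for i u
  have y_eq: "y n = (volterra p ^^ (M * n)) x" for n
    by (simp add: y_def funpow_mult)
  have y_pos: "0 < y n $ i" for n i
    unfolding y_eq by (rule volterra_pow_pos[OF p(1) x])
  have y_Suc: "y (Suc n) $ i = y n $ i * G i (y n)" for n i
    using volterra_pow_nth[of M p "y n" i] by (simp add: y_def G_def)
  obtain i where i: "0 < p * adv i q"
    using boundary_point_has_growing_coordinate[OF p(2) q] .
  have fixed_pow: "(volterra p ^^ k) q = q" for k
    by (induction k) (simp_all add: fixed)
  have "continuous_on UNIV (G i)"
    unfolding G_def
    by (intro continuous_intros
        continuous_on_compose2[OF continuous_on_adv continuous_on_funpow[OF continuous_on_volterra]]) auto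
  then have "(\<lambda>n. G i (y n)) \<longlonglongrightarrow> G i q"
    using lim unfolding y_def by (rule tendsto_continuous_image)
  moreover have "1 < G i q"
    using i M by (simp add: G_def fixed_pow one_less_power)
  ultimately have "eventually (\<lambda>n. 1 < G i (y n)) sequentially"
    by (rule order_tendstoD(1))
  then obtain n0 where n0: "\<And>n. n \<ge> n0 \<Longrightarrow> 1 < G i (y n)"
    by (auto simp: eventually_sequentially)
  have "y n0 $ i \<le> y n $ i" if "n \<ge> n0" for n
    using that
  proof (induction n rule: dec_induct)
    case (step n)
    have "y n $ i * 1 \<le> y n $ i * G i (y n)"
      using n0[of n] step(1) y_pos[of n i] by (intro mult_left_mono) auto
    with step show ?case by (simp add: y_Suc)
  qed simp
  moreover have "(\<lambda>n. y n $ i) \<longlonglongrightarrow> q $ i"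
    using lim unfolding y_def by (rule tendsto_vec_nth)
  ultimately have "y n0 $ i \<le> q $ i"
    by (intro LIMSEQ_le_const) auto
  then have "0 < q $ i" using y_pos[of n0 i] by linarith
  moreover have "q $ i * (1 + p * adv i q) = q $ i"
    using fixed volterra_nth[of p q i] by simp
  ultimately show False using i by (auto simp: distrib_left)
qed

theorem theorem5:
  fixes p :: real and P x0 :: "real ^ 5"
  assumes "p \<in> {-1..1}" and "p \<noteq> 0"
    and "P = vector [1/5, 1/5, 1/5, 1/5, 1/5]"
    and "x0 \<in> int_S4" and "x0 \<noteq> P"
  shows "infinite (limit_points (\<lambda>n. (W p ^^ n) x0)) \<and>
    limit_points (\<lambda>n. (W p ^^ n) x0) \<subseteq> boundary_S4"
proof
  let ?L = "limit_points (\<lambda>n. (W p ^^ n) x0)"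
  have x0: "x0 \<in> S4" using assms(4) by (simp add: int_S4_def)
  have x0_pos: "0 < x0 $ i" for i
  proof -
    have "x0 $ i \<noteq> 0"
      using assms(4) exhaust_5[of i] by (auto simp: int_S4_def)
    then show ?thesis using x0 by (simp add: S4_def less_le)
  qed
  have not_centre: "\<not> (\<forall>i. x0 $ i = 1/5)"
    using assms(3,5) by (auto simp: vec_eq_iff forall_5)
  have WS: "(W p ^^ n) x0 \<in> S4" for n
    by (induction n) (simp_all add: x0 W_maps_S4[OF assms(1)])
  show boundary: "?L \<subseteq> boundary_S4"
  proof
    fix l assume l: "l \<in> ?L"
    then obtain r where r: "strict_mono r" "(\<lambda>n. (W p ^^ r n) x0) \<longlonglongrightarrow> l"
      by (auto simp: limit_points_def o_def)
    have "(\<lambda>n. \<Prod>i\<in>UNIV. (W p ^^ r n) x0 $ i) \<longlonglongrightarrow> (\<Prod>i\<in>UNIV. l $ i)"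
      by (intro tendsto_intros r(2))
    moreover have "(\<lambda>n. \<Prod>i\<in>UNIV. (W p ^^ r n) x0 $ i) \<longlonglongrightarrow> 0"
      unfolding prod_W_pow
      using LIMSEQ_subseq_LIMSEQ[OF coordinate_product_tendsto_0[OF assms(1,2) x0 not_centre] r(1)]
      by (simp add: o_def)
    ultimately have "(\<Prod>i\<in>UNIV. l $ i) = 0" by (rule LIMSEQ_unique)
    moreover have "l \<in> S4"
      using limit_points_compact_subset[OF compact_S4, of "\<lambda>n. (W p ^^ n) x0"] WS l by blast
    ultimately show "l \<in> boundary_S4" by (simp add: boundary_S4_def prod_5)
  qed
  show "infinite ?L"
  proof
    assume fin: "finite ?L"
    (* The fifth iterate of W undoes the cyclic shift and equals that of the Volterra map. *)
    define T where "T = volterra p ^^ 5"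
    define y where "y n = (T ^^ n) x0" for n
    have y_eq: "y n = (W p ^^ (5 * n)) x0" for n
      by (simp add: y_def T_def W_pow_multiple_5 funpow_mult)
    have contT: "continuous_on UNIV T"
      unfolding T_def by (intro continuous_on_funpow continuous_on_volterra)
    have yS: "y n \<in> S4" for n unfolding y_eq by (rule WS)
    have "y = (\<lambda>n. (W p ^^ n) x0) \<circ> (\<lambda>n. 5 * n)" by (simp add: fun_eq_iff y_eq)
    then have sub: "limit_points y \<subseteq> ?L"
      using limit_points_subseq_subset[of "\<lambda>n. 5 * n" "\<lambda>n. (W p ^^ n) x0"]
      by (simp add: strict_mono_def)
    then have fin_y: "finite (limit_points y)" using fin by (rule finite_subset)
    have LS: "l \<in> S4" if "l \<in> limit_points y" for l
      using that sub boundary by (auto simp: boundary_S4_def)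
    have fixed: "volterra p l = l" if l: "l \<in> limit_points y" for l
    proof -
      obtain N where "N > 0" "(T ^^ N) l = l"
        using finite_limit_points_periodic[OF compact_S4 contT, of x0 l] yS fin_y l
        unfolding y_def[abs_def] by blast
      then show ?thesis
        using volterra_periodic_imp_fixed[OF assms(1) LS[OF l], of "5 * N"]
        by (simp add: T_def funpow_mult)
    qed
    have T_fixed: "T l = l" if "l \<in> limit_points y" for l
      by (simp add: T_def eval_nat_numeral fixed[OF that])
    have y_Suc: "y (Suc n) = T (y n)" for n by (simp add: y_def)
    have steps: "(\<lambda>n. dist (y (Suc n)) (y n)) \<longlonglongrightarrow> 0"
    proof (rule metric_LIMSEQ_I)
      fix e :: real assume "e > 0"
      have "closed {u. e \<le> dist (T u) u}"
        by (intro closed_Collect_le continuous_intros contT)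
      then have "eventually (\<lambda>n. y n \<notin> {u. e \<le> dist (T u) u}) sequentially"
        using T_fixed \<open>e > 0\<close>
        by (intro eventually_avoids_closed_without_limit_points[OF compact_S4 yS]) auto
      then show "\<exists>no. \<forall>n\<ge>no. dist (dist (y (Suc n)) (y n)) 0 < e"
        by (simp add: eventually_sequentially y_Suc not_le)
    qed
    obtain l where l: "l \<in> limit_points y"
      using convergent_subsequence_in_compact[OF compact_S4, of y] yS unfolding limit_points_def by blast
    have "y \<longlonglongrightarrow> l"
      by (rule convergent_if_steps_vanish_finite_limit_points[OF compact_S4 yS steps fin_y l])
    moreover have "(\<Prod>i\<in>UNIV. l $ i) = 0"
      using l sub boundary by (auto simp: boundary_S4_def prod_5)
    ultimately show False
      using interior_orbit_not_convergent[OF assms(1,2) x0 x0_pos _ _ fixed[OF l] LS[OF l], of 5]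
      unfolding y_def[abs_def] T_def by simp
  qed
qed

end
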